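(* Let $\mathfrak{g}$ be a Lie algebra over $\mathbb{F}$. There is a one-to-one correspondence between Lie affgebras with Lie fibre $\mathfrak{g}$ and generalised derivations $(\delta,\lambda,\lambda)$ of $\mathfrak{g}$ supplemented with an element of $\mathfrak{g}$.
   Context: $\mathbb{F}$ is a field of characteristic different from 2. Generalised derivations: for a Lie algebra $\mathfrak{g}$, $\Delta(\mathfrak{g})$ is the set of triples $(\lambda,\lambda',\lambda'')$ of linear endomorphisms of $\mathfrak{g}$ with $[\lambda(a),b]+[a,\lambda'(b)]=\lambda''([a,b])$ for all $a,b\in\mathfrak{g}$; such triples are called generalised derivations of $\mathfrak{g}$. Thus $(\delta,\lambda,\lambda)$ is a generalised derivation if and only if $[\delta(a),b]+[a,\lambda(b)]=\lambda([a,b])$ for all $a,b\in\mathfrak{g}$. Abelian heap: a set $X$ with a ternary operation $\langle-,-,-\rangle$ satisfying $\langle x_1,x_2,x_3\rangle=\langle x_3,x_2,x_1\rangle$, $\langle x_1,x_1,x_2\rangle=x_2$, $\langle\langle x_1,x_2,x_3\rangle,x_4,x_5\rangle=\langle x_1,x_2,\langle x_3,x_4,x_5\rangle\rangle$ (the latter is written $\langle x_1,\dots,x_5\rangle$). Affine space over $\mathbb{F}$: a non-empty set $\mathfrak{a}$ with an abelian heap operation and an operation $(\alpha,a,b)\mapsto\alpha\triangleright_a b$, $\mathbb{F}\times\mathfrak{a}^2\to\mathfrak{a}$, such that $\alpha\triangleright_a-$ and $-\triangleright_a b$ are heap homomorphisms ($\mathbb{F}$ being a heap via $\alpha-\beta+\gamma$);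 $(\alpha\beta)\triangleright_a b=\alpha\triangleright_a(\beta\triangleright_a b)$; $1\triangleright_a b=b$; $0\triangleright_a b=a$; $\alpha\triangleright_a b=\langle\alpha\triangleright_c b,\alpha\triangleright_c a,a\rangle$. An affine map is a heap homomorphism $f$ with $f(\alpha\triangleright_a b)=\alpha\triangleright_{f(a)}f(b)$. For $o\in\mathfrak{a}$, the tangent space $T_o\mathfrak{a}$ is the vector space on the set $\mathfrak{a}$ with $a+b=\langle a,o,b\rangle$, zero $o$, and $\alpha a=\alpha\triangleright_o a$. Lie affgebra: an affine space $\mathfrak{a}$ with an operation $\{-,-\}:\mathfrak{a}^2\to\mathfrak{a}$, affine in each argument, such that for all $a,b,c\in\mathfrak{a}$: $\langle\{a,b\},\{a,a\},\{b,a\}\rangle=\{b,b\}$ and $\langle\{a,\{b,c\}\},\{a,\{a,a\}\},\{b,\{c,a\}\},\{b,\{b,b\}\},\{c,\{a,b\}\}\rangle=\{c,\{c,c\}\}$. The Lie fibre (tangent Lie algebra) of $\mathfrak{a}$ at $o\in\mathfrak{a}$ is the vector space $T_o\mathfrak{a}$ with the Lie bracket $[a,b]=\{a,b\}-\{a,o\}+\{o,o\}-\{o,b\}$; the fibres at different points are isomorphic Lie algebras. *)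

theory Defs
  imports Complex_Main
begin

text \<open>All structures live on whole types, so that affine spaces are automatically non-empty and
  two structures on the same set are the same exactly when their operations are equal.\<close>

section \<open>Lie algebras and generalised derivations\<close>

text \<open>The axiom that the bracket of an element with itself vanishes is, in characteristic different
  from 2, the same as antisymmetry.\<close>

locale lie_algebra = vector_space scale
  for scale :: "'k::field \<Rightarrow> 'g::ab_group_add \<Rightarrow> 'g" +
  fixes bracket :: "'g \<Rightarrow> 'g \<Rightarrow> 'g"
  assumes linear_bracket_left: "Vector_Spaces.linear scale scale (\<lambda>a. bracket a b)"
    and linear_bracket_right: "Vector_Spaces.linear scale scale (\<lambda>b. bracket a b)"
    and bracket_self: "bracket a a = 0"
    and jacobi: "bracket a (bracket b c) + bracket b (bracket c a) + bracket c (bracket a b) = 0"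

definition gen_derivations ::
    "('k::field \<Rightarrow> 'g::ab_group_add \<Rightarrow> 'g) \<Rightarrow> ('g \<Rightarrow> 'g \<Rightarrow> 'g) \<Rightarrow>
      (('g \<Rightarrow> 'g) \<times> ('g \<Rightarrow> 'g) \<times> ('g \<Rightarrow> 'g)) set" where
  "gen_derivations scale bracket =
    {(l, l', l''). Vector_Spaces.linear scale scale l \<and>
       Vector_Spaces.linear scale scale l' \<and>
       Vector_Spaces.linear scale scale l'' \<and>
       (\<forall>a b. bracket (l a) b + bracket a (l' b) = l'' (bracket a b))}"

section \<open>Abelian heaps and affine spaces\<close>

locale abelian_heap =
  fixes heap :: "'a \<Rightarrow> 'a \<Rightarrow> 'a \<Rightarrow> 'a"
  assumes heap_commute: "heap x1 x2 x3 = heap x3 x2 x1"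
    and heap_cancel: "heap x1 x1 x2 = x2"
    and heap_assoc: "heap (heap x1 x2 x3) x4 x5 = heap x1 x2 (heap x3 x4 x5)"

definition heap_hom ::
    "('a \<Rightarrow> 'a \<Rightarrow> 'a \<Rightarrow> 'a) \<Rightarrow> ('b \<Rightarrow> 'b \<Rightarrow> 'b \<Rightarrow> 'b) \<Rightarrow> ('a \<Rightarrow> 'b) \<Rightarrow> bool" where
  "heap_hom h h' f \<longleftrightarrow> (\<forall>x y z. f (h x y z) = h' (f x) (f y) (f z))"

definition group_heap :: "'a::ab_group_add \<Rightarrow> 'a \<Rightarrow> 'a \<Rightarrow> 'a" where
  "group_heap x y z = x - y + z"

text \<open>\<open>act \<alpha> a b\<close> stands for \<open>\<alpha> \<triangleright>\<^sub>a b\<close>.\<close>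

locale affine_space = abelian_heap heap
  for heap :: "'a \<Rightarrow> 'a \<Rightarrow> 'a \<Rightarrow> 'a" +
  fixes act :: "'k::field \<Rightarrow> 'a \<Rightarrow> 'a \<Rightarrow> 'a"
  assumes act_hom_point: "heap_hom heap heap (\<lambda>b. act \<alpha> a b)"
    and act_hom_scalar: "heap_hom group_heap heap (\<lambda>\<alpha>. act \<alpha> a b)"
    and act_mult: "act (\<alpha> * \<beta>) a b = act \<alpha> a (act \<beta> a b)"
    and act_one: "act 1 a b = b"
    and act_zero: "act 0 a b = a"
    and act_base_change: "act \<alpha> a b = heap (act \<alpha> c b) (act \<alpha> c a) a"

definition affine_map ::
    "('a \<Rightarrow> 'a \<Rightarrow> 'a \<Rightarrow> 'a) \<Rightarrow> ('k \<Rightarrow> 'a \<Rightarrow> 'a \<Rightarrow> 'a) \<Rightarrow>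
     ('b \<Rightarrow> 'b \<Rightarrow> 'b \<Rightarrow> 'b) \<Rightarrow> ('k \<Rightarrow> 'b \<Rightarrow> 'b \<Rightarrow> 'b) \<Rightarrow> ('a \<Rightarrow> 'b) \<Rightarrow> bool" where
  "affine_map h act h' act' f \<longleftrightarrow>
     heap_hom h h' f \<and> (\<forall>\<alpha> a b. f (act \<alpha> a b) = act' \<alpha> (f a) (f b))"

section \<open>Lie affgebras and their Lie fibres\<close>

record ('k, 'a) affgebra =
  heap :: "'a \<Rightarrow> 'a \<Rightarrow> 'a \<Rightarrow> 'a"
  act :: "'k \<Rightarrow> 'a \<Rightarrow> 'a \<Rightarrow> 'a"
  aff_bracket :: "'a \<Rightarrow> 'a \<Rightarrow> 'a"

definition heap5 ::
    "('a \<Rightarrow> 'a \<Rightarrow> 'a \<Rightarrow> 'a) \<Rightarrow> 'a \<Rightarrow> 'a \<Rightarrow> 'a \<Rightarrow> 'a \<Rightarrow> 'a \<Rightarrow> 'a" where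
  "heap5 h x1 x2 x3 x4 x5 = h x1 x2 (h x3 x4 x5)"

definition lie_affgebra :: "('k::field, 'a) affgebra \<Rightarrow> bool" where
  "lie_affgebra L \<longleftrightarrow>
    (let h = heap L; t = act L; br = aff_bracket L in
      affine_space h t \<and>
      (\<forall>b. affine_map h t h t (\<lambda>a. br a b)) \<and>
      (\<forall>a. affine_map h t h t (\<lambda>b. br a b)) \<and>
      (\<forall>a b. h (br a b) (br a a) (br b a) = br b b) \<and>
      (\<forall>a b c. heap5 h (br a (br b c)) (br a (br a a)) (br b (br c a)) (br b (br b b))
                 (br c (br a b)) = br c (br c c)))"

definition tangent_add :: "('k, 'a) affgebra \<Rightarrow> 'a \<Rightarrow> 'a \<Rightarrow> 'a \<Rightarrow> 'a" where
  "tangent_add L o' a b = heap L a o' b"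

text \<open>The negative of \<open>b\<close> in the tangent space at \<open>o'\<close> is \<open>\<langle>o', b, o'\<rangle>\<close>.\<close>

definition tangent_diff :: "('k, 'a) affgebra \<Rightarrow> 'a \<Rightarrow> 'a \<Rightarrow> 'a \<Rightarrow> 'a" where
  "tangent_diff L o' a b = tangent_add L o' a (heap L o' b o')"

definition tangent_bracket :: "('k, 'a) affgebra \<Rightarrow> 'a \<Rightarrow> 'a \<Rightarrow> 'a \<Rightarrow> 'a" where
  "tangent_bracket L o' a b =
    (let br = aff_bracket L in
      tangent_diff L o'
        (tangent_add L o' (tangent_diff L o' (br a b) (br a o')) (br o' o'))
        (br o' b))"

record ('k, 'a) lie_structure =
  lie_add :: "'a \<Rightarrow> 'a \<Rightarrow> 'a"
  lie_zero :: "'a"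
  lie_scale :: "'k \<Rightarrow> 'a \<Rightarrow> 'a"
  lie_bracket :: "'a \<Rightarrow> 'a \<Rightarrow> 'a"

definition lie_fibre :: "('k, 'a) affgebra \<Rightarrow> 'a \<Rightarrow> ('k, 'a) lie_structure" where
  "lie_fibre L o' =
    \<lparr>lie_add = tangent_add L o', lie_zero = o', lie_scale = (\<lambda>\<alpha> a. act L \<alpha> o' a),
     lie_bracket = tangent_bracket L o'\<rparr>"

definition lie_structure_of ::
    "('k::field \<Rightarrow> 'g::ab_group_add \<Rightarrow> 'g) \<Rightarrow> ('g \<Rightarrow> 'g \<Rightarrow> 'g) \<Rightarrow> ('k, 'g) lie_structure" where
  "lie_structure_of scale bracket =
    \<lparr>lie_add = (+), lie_zero = 0, lie_scale = scale, lie_bracket = bracket\<rparr>"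

text \<open>The base point of the fibre need not be prescribed: equality with the given Lie algebra forces
  it to be the zero vector.\<close>

definition lie_affgebras_with_fibre ::
    "('k::field \<Rightarrow> 'g::ab_group_add \<Rightarrow> 'g) \<Rightarrow> ('g \<Rightarrow> 'g \<Rightarrow> 'g) \<Rightarrow> ('k, 'g) affgebra set" where
  "lie_affgebras_with_fibre scale bracket =
    {L. lie_affgebra L \<and> (\<exists>o'. lie_fibre L o' = lie_structure_of scale bracket)}"

section \<open>The Lie affgebra of a generalised derivation and an element\<close>

text \<open>The sign of \<open>\<delta>\<close>: writing a bi-affine bracket with fibre bracket \<open>[a,b]\<close> as
  \<open>{a,b} = [a,b] + \<kappa>(a) + \<lambda>(b) + s\<close> with linear \<open>\<kappa>\<close> and \<open>\<lambda>\<close>, the affine Jacobi identity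
  amounts to \<open>[a,\<lambda>(b)] - [\<kappa>(a),b] = \<lambda>([a,b])\<close>, i.e. \<open>(-\<kappa>,\<lambda>,\<lambda>)\<close> is a generalised derivation.\<close>

definition affgebra_of ::
    "('k::field \<Rightarrow> 'g::ab_group_add \<Rightarrow> 'g) \<Rightarrow> ('g \<Rightarrow> 'g \<Rightarrow> 'g) \<Rightarrow>
      ('g \<Rightarrow> 'g) \<Rightarrow> ('g \<Rightarrow> 'g) \<Rightarrow> 'g \<Rightarrow> ('k, 'g) affgebra" where
  "affgebra_of scale bracket \<delta> \<mu> s =
    \<lparr>heap = group_heap,
     act = (\<lambda>\<alpha> a b. a + scale \<alpha> (b - a)),
     aff_bracket = (\<lambda>a b. bracket a b - \<delta> a + \<mu> b + s)\<rparr>"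

end

theory Submission
  imports Defs
begin

text \<open>Fixing the fibre at one point fixes the whole affine structure, because every heap and every
  scalar action is recovered from addition and scaling in a tangent space
  (\<open>heap_from_tangent\<close>, \<open>act_from_tangent\<close>).  Only the bi-affine bracket \<open>{a,b}\<close> remains free.
  A bi-affine map on a vector space splits uniquely as a bilinear part, a linear map of
  \<open>a\<close>, a linear map of \<open>b\<close> and a constant.  The fibre bracket is exactly the bilinear part, so

    \<open>{a,b} = [a,b] - \<delta>(a) + \<mu>(b) + s\<close>

  where \<open>[a,b]\<close> is given and the linear maps \<open>\<delta>\<close>, \<open>\<mu>\<close> and the vector \<open>s\<close> are arbitrary and determined
  by the affgebra.  Affine antisymmetry then holds for free.  In the affine Jacobi identity the
  terms \<open>s\<close>, \<open>\<mu>\<delta>\<close> and \<open>\<mu>\<mu>\<close> cancel and the Jacobi identity of the fibre removes the triple brackets;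
  each remaining term involves at most two of the three arguments, and together
  they vanish exactly when \<open>[\<delta>(a),b] + [a,\<mu>(b)] = \<mu>([a,b])\<close> (\<open>affine_jacobi_iff\<close>).\<close>

section \<open>Affine structures and tangent spaces\<close>

lemma (in abelian_heap) heap_cancel_right: "heap x y y = x"
  by (metis heap_commute heap_cancel)

text \<open>Re-bracketing \<open>\<langle>a,b,c\<rangle>\<close> through the base point \<open>0\<close> turns it into a sum of \<open>a\<close>,
  \<open>\<langle>0,b,0\<rangle>\<close> and \<open>c\<close>, and \<open>\<langle>0,b,0\<rangle>\<close> is the inverse of \<open>b\<close>.\<close>

lemma heap_from_tangent:
  fixes h :: "'a::ab_group_add \<Rightarrow> 'a \<Rightarrow> 'a \<Rightarrow> 'a"
  assumes "abelian_heap h" and tangent: "\<And>a b. h a 0 b = a + b"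
  shows "h = group_heap"
proof -
  interpret abelian_heap h by fact
  have "h a b c = a - b + c" for a b c
  proof -
    have "b + h 0 b 0 = 0"
      by (metis tangent heap_assoc heap_cancel heap_cancel_right)
    then have inverse: "h 0 b 0 = - b"
      by (simp add: eq_neg_iff_add_eq_0 add.commute)
    have "h a b c = h a 0 (h (h 0 b 0) 0 c)"
      by (metis heap_assoc heap_cancel heap_cancel_right)
    then show ?thesis
      by (simp add: tangent inverse)
  qed
  then show ?thesis
    by (simp add: fun_eq_iff group_heap_def)
qed

lemma act_from_tangent:
  fixes scale :: "'k::field \<Rightarrow> 'g::ab_group_add \<Rightarrow> 'g"
  assumes "vector_space scale" and "affine_space group_heap t"
    and tangent: "\<And>\<alpha> a. t \<alpha> 0 a = scale \<alpha> a"
  shows "t = (\<lambda>\<alpha> a b. a + scale \<alpha> (b - a))"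
proof -
  interpret vector_space scale by fact
  interpret affine_space group_heap t by fact
  have "t \<alpha> a b = a + scale \<alpha> (b - a)" for \<alpha> a b
    using act_base_change[of \<alpha> a b 0]
    by (simp add: tangent group_heap_def scale_right_diff_distrib)
  then show ?thesis
    by (simp add: fun_eq_iff)
qed

context vector_space
begin

lemma affine_space_of_vector_space:
  "affine_space group_heap (\<lambda>\<alpha> a b. a + scale \<alpha> (b - a))"
  by unfold_locales
    (simp_all add: heap_hom_def group_heap_def scale_right_diff_distrib scale_right_distrib
      scale_left_diff_distrib scale_left_distrib)

lemma affine_map_of_linear:
  assumes "Vector_Spaces.linear scale scale f"
  shows "affine_map group_heap (\<lambda>\<alpha> a b. a + scale \<alpha> (b - a))
           group_heap (\<lambda>\<alpha> a b. a + scale \<alpha> (b - a)) (\<lambda>x. f x + c)"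
proof -
  interpret f: Vector_Spaces.linear scale scale f by fact
  show ?thesis
    by (simp add: affine_map_def heap_hom_def group_heap_def f.add f.diff f.scale)
qed

lemma linear_of_affine_map:
  assumes "affine_map group_heap (\<lambda>\<alpha> a b. a + scale \<alpha> (b - a))
             group_heap (\<lambda>\<alpha> a b. a + scale \<alpha> (b - a)) f"
  shows "Vector_Spaces.linear scale scale (\<lambda>x. f x - f 0)"
proof -
  have heap: "f (x - y + z) = f x - f y + f z" for x y z
    using assms by (simp add: affine_map_def heap_hom_def group_heap_def)
  have act: "f (a + scale \<alpha> (b - a)) = f a + scale \<alpha> (f b - f a)" for \<alpha> a b
    using assms by (simp add: affine_map_def)
  show ?thesis
  proof unfold_locales
    fix x y
    show "f (x + y) - f 0 = f x - f 0 + (f y - f 0)"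
      using heap[of x 0 y] by simp
  next
    fix r x
    show "f (scale r x) - f 0 = scale r (f x - f 0)"
      using act[of 0 r x] by simp
  qed
qed

end

section \<open>The affine Jacobi identity\<close>

context lie_algebra
begin

sublocale left: Vector_Spaces.linear scale scale "\<lambda>a. bracket a b" for b
  by (rule linear_bracket_left)

sublocale right: Vector_Spaces.linear scale scale "\<lambda>b. bracket a b" for a
  by (rule linear_bracket_right)

sublocale linear_pair: vector_space_pair scale scale ..

lemma bracket_antisym: "bracket b a = - bracket a b"
proof -
  have "bracket b a + bracket a b = bracket (b + a) (b + a)"
    by (simp add: left.add right.add bracket_self[of a] bracket_self[of b])
  then show ?thesis
    by (simp add: bracket_self eq_neg_iff_add_eq_0)
qed

text \<open>What remains of the affine Jacobi identity after cancellation is a sum of terms in at most two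
  of the three arguments, so nothing is lost by putting \<open>c = 0\<close>.  Putting also \<open>b = 0\<close> shows that
  \<open>\<phi> = \<mu> - \<delta>\<close> satisfies \<open>[a,\<phi>(a)] = 0\<close>; polarising this to
  \<open>[a,\<phi>(b)] + [b,\<phi>(a)] = 0\<close> trades \<open>\<delta>\<close> for \<open>\<mu>\<close> and brings the two-argument identity into the
  required form.\<close>

lemma affine_jacobi_iff:
  assumes "Vector_Spaces.linear scale scale \<delta>" and "Vector_Spaces.linear scale scale \<mu>"
    and br: "\<And>a b. br a b = bracket a b - \<delta> a + \<mu> b + s"
  shows "(\<forall>a b c. heap5 group_heap (br a (br b c)) (br a (br a a)) (br b (br c a))
             (br b (br b b)) (br c (br a b)) = br c (br c c)) \<longleftrightarrow>
         (\<forall>a b. bracket (\<delta> a) b + bracket a (\<mu> b) = \<mu> (bracket a b))"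
    (is "?jacobi \<longleftrightarrow> ?derivation")
proof -
  interpret \<delta>: Vector_Spaces.linear scale scale \<delta> by fact
  interpret \<mu>: Vector_Spaces.linear scale scale \<mu> by fact
  define \<phi> where "\<phi> = (\<lambda>a. \<mu> a - \<delta> a)"
  \<comment> \<open>\<open>R a b c\<close> keeps the single brackets of \<open>{a,{b,c}} - {a,{a,a}}\<close>; its double bracket and its
    bracket-free part have cyclic sum zero.\<close>
  define R where "R = (\<lambda>a b c. bracket a (\<mu> c - \<delta> b - \<phi> a) + \<mu> (bracket b c))"
  have difference: "br a (br b c) - br a (br a a) =
      bracket a (bracket b c) + R a b c + \<mu> (\<mu> c - \<delta> b - \<phi> a)" for a b c
    by (simp add: br R_def \<phi>_def bracket_self right.add right.diff \<mu>.add \<mu>.diff algebra_simps)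
  have jacobi_iff: "?jacobi \<longleftrightarrow> (\<forall>a b c. R a b c + R b c a + R c a b = 0)"
  proof -
    have "heap5 group_heap (br a (br b c)) (br a (br a a)) (br b (br c a))
            (br b (br b b)) (br c (br a b)) - br c (br c c) =
          R a b c + R b c a + R c a b" for a b c
    proof -
      have "heap5 group_heap (br a (br b c)) (br a (br a a)) (br b (br c a))
              (br b (br b b)) (br c (br a b)) - br c (br c c) =
            (br a (br b c) - br a (br a a)) + (br b (br c a) - br b (br b b)) +
            (br c (br a b) - br c (br c c))"
        by (simp add: heap5_def group_heap_def algebra_simps)
      also have "\<dots> = R a b c + R b c a + R c a b +
          (bracket a (bracket b c) + bracket b (bracket c a) + bracket c (bracket a b))"
        unfolding difference by (simp add: \<phi>_def \<mu>.diff algebra_simps)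
      finally show ?thesis
        by (simp add: jacobi)
    qed
    then show ?thesis
      by (metis eq_iff_diff_eq_0)
  qed
  have polarise: "bracket a (\<phi> b) + bracket b (\<phi> a) = 0"
    if diagonal: "\<And>a. bracket a (\<phi> a) = 0" for a b
    using diagonal[of "a + b"] diagonal[of a] diagonal[of b]
    by (simp add: \<phi>_def left.add right.add right.diff \<delta>.add \<mu>.add algebra_simps)
  show ?thesis
  proof
    assume ?jacobi
    then have cyclic: "R a b c + R b c a + R c a b = 0" for a b c
      using jacobi_iff by blast
    have diagonal: "bracket a (\<phi> a) = 0" for a
      using cyclic[of a 0 0] by (simp add: R_def \<phi>_def right.neg right.diff)
    show ?derivation
    proof (intro allI)
      fix a b
      have "bracket b (\<mu> a) - bracket a (\<delta> b) + \<mu> (bracket a b) = 0"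
        using cyclic[of a b 0]
        by (simp add: R_def diagonal right.diff right.neg add.commute)
      moreover have "bracket b (\<mu> a) = bracket b (\<delta> a) + bracket a (\<delta> b) - bracket a (\<mu> b)"
        using polarise[OF diagonal, of a b] by (simp add: \<phi>_def right.diff algebra_simps)
      ultimately have "bracket b (\<delta> a) - bracket a (\<mu> b) + \<mu> (bracket a b) = 0"
        by (simp add: algebra_simps)
      then show "bracket (\<delta> a) b + bracket a (\<mu> b) = \<mu> (bracket a b)"
        using bracket_antisym[of "\<delta> a" b] by (simp add: algebra_simps)
    qed
  next
    assume ?derivation
    then have derivation: "\<mu> (bracket a b) = bracket (\<delta> a) b + bracket a (\<mu> b)" for a b
      by simp
    have diagonal: "bracket a (\<phi> a) = 0" for a
      using derivation[of a a] bracket_antisym[of "\<delta> a" a]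
      by (simp add: \<phi>_def bracket_self right.diff)
    have reduced: "R a b c =
        bracket a (\<mu> c) - bracket a (\<delta> b) - bracket c (\<delta> b) + bracket b (\<mu> c)" for a b c
      by (simp add: R_def derivation right.diff diagonal bracket_antisym[of "\<delta> b" c])
    \<comment> \<open>The cyclic sum runs over \<open>[x,\<phi>(y)]\<close> for all ordered pairs of distinct arguments.\<close>
    have "R a b c + R b c a + R c a b =
        (bracket a (\<phi> b) + bracket b (\<phi> a)) + (bracket b (\<phi> c) + bracket c (\<phi> b)) +
        (bracket c (\<phi> a) + bracket a (\<phi> c))" for a b c
      by (simp add: reduced \<phi>_def right.diff algebra_simps)
    then show ?jacobi
      unfolding jacobi_iff by (simp add: polarise[OF diagonal])
  qed
qed

section \<open>The correspondence\<close>

lemma lie_affgebra_affgebra_of_iff: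
  assumes \<delta>: "Vector_Spaces.linear scale scale \<delta>" and \<mu>: "Vector_Spaces.linear scale scale \<mu>"
  shows "lie_affgebra (affgebra_of scale bracket \<delta> \<mu> s) \<longleftrightarrow>
         (\<forall>a b. bracket (\<delta> a) b + bracket a (\<mu> b) = \<mu> (bracket a b))"
proof -
  interpret \<delta>: Vector_Spaces.linear scale scale \<delta> by fact
  interpret \<mu>: Vector_Spaces.linear scale scale \<mu> by fact
  let ?t = "\<lambda>\<alpha> a b. a + scale \<alpha> (b - a)"
  define br where "br = (\<lambda>a b. bracket a b - \<delta> a + \<mu> b + s)"
  have "affine_map group_heap ?t group_heap ?t (\<lambda>a. br a b)" for b
  proof -
    have "Vector_Spaces.linear scale scale (\<lambda>a. bracket a b - \<delta> a)"
      by (intro linear_pair.linear_compose_sub linear_bracket_left \<delta>)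
    from affine_map_of_linear[OF this, of "\<mu> b + s"] show ?thesis
      by (simp add: br_def add.assoc)
  qed
  moreover have "affine_map group_heap ?t group_heap ?t (\<lambda>b. br a b)" for a
  proof -
    have "Vector_Spaces.linear scale scale (\<lambda>b. bracket a b + \<mu> b)"
      by (intro linear_pair.linear_compose_add linear_bracket_right \<mu>)
    from affine_map_of_linear[OF this, of "s - \<delta> a"] show ?thesis
      by (simp add: br_def algebra_simps)
  qed
  moreover have "group_heap (br a b) (br a a) (br b a) = br b b" for a b
    using bracket_antisym[of a b] by (simp add: br_def group_heap_def bracket_self)
  ultimately show ?thesis
    unfolding affine_jacobi_iff[OF \<delta> \<mu>, of br s, OF fun_cong[OF fun_cong[OF br_def]], symmetric]
    by (simp add: lie_affgebra_def affgebra_of_def Let_def affine_space_of_vector_space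
        flip: br_def)
qed

lemma lie_fibre_affgebra_of:
  assumes "Vector_Spaces.linear scale scale \<delta>" and "Vector_Spaces.linear scale scale \<mu>"
  shows "lie_fibre (affgebra_of scale bracket \<delta> \<mu> s) 0 = lie_structure_of scale bracket"
proof -
  interpret \<delta>: Vector_Spaces.linear scale scale \<delta> by fact
  interpret \<mu>: Vector_Spaces.linear scale scale \<mu> by fact
  show ?thesis
    by (simp add: lie_fibre_def lie_structure_of_def affgebra_of_def tangent_bracket_def
        tangent_diff_def tangent_add_def group_heap_def fun_eq_iff Let_def)
qed

text \<open>The base point of the fibre has to be \<open>0\<close>, so that the fibre supplies the hypotheses of
  \<open>heap_from_tangent\<close> and \<open>act_from_tangent\<close>.  The parameters are then read off from the bracket
  on the two axes: \<open>s = {0,0}\<close>, \<open>-\<delta>(a) = {a,0} - {0,0}\<close> and \<open>\<mu>(b) = {0,b} - {0,0}\<close>, while the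
  defect of \<open>{a,b}\<close> from being the sum of these is the fibre bracket by definition.\<close>

lemma affgebra_of_parameters:
  assumes "L \<in> lie_affgebras_with_fibre scale bracket"
  obtains \<delta> \<mu> s where "Vector_Spaces.linear scale scale \<delta>"
    and "Vector_Spaces.linear scale scale \<mu>" and "L = affgebra_of scale bracket \<delta> \<mu> s"
proof -
  let ?t = "\<lambda>\<alpha> a b. a + scale \<alpha> (b - a)"
  define br where "br = aff_bracket L"
  define \<kappa> where "\<kappa> = (\<lambda>a. br a 0 - br 0 0)"
  define \<mu> where "\<mu> = (\<lambda>b. br 0 b - br 0 0)"
  from assms obtain p where L: "lie_affgebra L"
    and fibre: "lie_fibre L p = lie_structure_of scale bracket"
    by (auto simp: lie_affgebras_with_fibre_def)
  have "p = 0"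
    using fibre by (simp add: lie_fibre_def lie_structure_of_def)
  then have add: "heap L a 0 b = a + b" and scale: "act L \<alpha> 0 a = scale \<alpha> a"
    and fibre_bracket: "tangent_bracket L 0 a b = bracket a b" for a b \<alpha>
    using fibre by (auto simp: lie_fibre_def lie_structure_of_def tangent_add_def fun_eq_iff)
  have space: "affine_space (heap L) (act L)"
    using L by (simp add: lie_affgebra_def Let_def)
  have heap: "heap L = group_heap"
    using heap_from_tangent[of "heap L"] affine_space.axioms(1)[OF space] add by blast
  have act: "act L = ?t"
    using act_from_tangent[OF vector_space_axioms, of "act L"] space heap scale by simp
  have bracket: "bracket a b = br a b - br a 0 + br 0 0 - br 0 b" for a b
    unfolding fibre_bracket[symmetric]
    by (simp add: tangent_bracket_def tangent_diff_def tangent_add_def heap group_heap_def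
        br_def Let_def)
  have \<kappa>: "Vector_Spaces.linear scale scale \<kappa>"
    unfolding \<kappa>_def
    using L by (intro linear_of_affine_map) (simp add: lie_affgebra_def Let_def heap act br_def)
  have \<mu>: "Vector_Spaces.linear scale scale \<mu>"
    unfolding \<mu>_def
    using L by (intro linear_of_affine_map) (simp add: lie_affgebra_def Let_def heap act br_def)
  have "aff_bracket L = (\<lambda>a b. bracket a b - (- \<kappa> a) + \<mu> b + br 0 0)"
    by (simp add: bracket \<kappa>_def \<mu>_def fun_eq_iff flip: br_def)
  then have "L = affgebra_of scale bracket (\<lambda>a. - \<kappa> a) \<mu> (br 0 0)"
    by (simp add: affgebra_of_def heap act affgebra.equality)
  then show thesis
    using that linear_pair.linear_compose_neg[OF \<kappa>] \<mu> by blast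
qed

lemma affgebra_of_injective:
  assumes "Vector_Spaces.linear scale scale \<delta>" and "Vector_Spaces.linear scale scale \<mu>"
    and "Vector_Spaces.linear scale scale \<delta>'" and "Vector_Spaces.linear scale scale \<mu>'"
    and eq: "affgebra_of scale bracket \<delta> \<mu> s = affgebra_of scale bracket \<delta>' \<mu>' s'"
  shows "\<delta> = \<delta>' \<and> \<mu> = \<mu>' \<and> s = s'"
proof -
  interpret \<delta>: Vector_Spaces.linear scale scale \<delta> by fact
  interpret \<mu>: Vector_Spaces.linear scale scale \<mu> by fact
  interpret \<delta>': Vector_Spaces.linear scale scale \<delta>' by fact
  interpret \<mu>': Vector_Spaces.linear scale scale \<mu>' by fact
  have br: "bracket a b - \<delta> a + \<mu> b + s = bracket a b - \<delta>' a + \<mu>' b + s'" for a b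
    using eq by (simp add: affgebra_of_def fun_eq_iff)
  have "s = s'"
    using br[of 0 0] by simp
  then show ?thesis
    using br[of _ 0] br[of 0] by (auto simp: fun_eq_iff)
qed

end

theorem corollary3p3:
  fixes scale :: "'k::field \<Rightarrow> 'g::ab_group_add \<Rightarrow> 'g"
    and bracket :: "'g \<Rightarrow> 'g \<Rightarrow> 'g"
  assumes "CHAR('k) \<noteq> 2"
    and "lie_algebra scale bracket"
  shows "bij_betw (\<lambda>((\<delta>, l, l'), s). affgebra_of scale bracket \<delta> l s)
           ({(\<delta>, l, l'). (\<delta>, l, l') \<in> gen_derivations scale bracket \<and> l = l'} \<times> (UNIV :: 'g set))
           (lie_affgebras_with_fibre scale bracket)"
    (is "bij_betw ?F ?D ?A")
proof -
  interpret lie_algebra scale bracket by fact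
  have D: "((\<delta>, l, l'), s) \<in> ?D \<longleftrightarrow>
      l' = l \<and> Vector_Spaces.linear scale scale \<delta> \<and> Vector_Spaces.linear scale scale l \<and>
      lie_affgebra (affgebra_of scale bracket \<delta> l s)" for \<delta> l l' s
    using lie_affgebra_affgebra_of_iff[of \<delta> l s] by (auto simp: gen_derivations_def)
  show ?thesis
  proof (rule bij_betw_imageI)
    show "inj_on ?F ?D"
    proof (rule inj_onI)
      fix x y
      assume x: "x \<in> ?D" and y: "y \<in> ?D" and eq: "?F x = ?F y"
      obtain \<delta> l m s where xs: "x = ((\<delta>, l, m), s)" by (metis surj_pair)
      obtain \<delta>' l' m' s' where ys: "y = ((\<delta>', l', m'), s')" by (metis surj_pair)
      show "x = y"
        using x y eq affgebra_of_injective[of \<delta> l \<delta>' l' s s'] unfolding xs ys D by simp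
    qed
    show "?F ` ?D = ?A"
    proof
      show "?F ` ?D \<subseteq> ?A"
      proof
        fix L
        assume "L \<in> ?F ` ?D"
        then obtain \<delta> l l' s where "((\<delta>, l, l'), s) \<in> ?D" and "L = affgebra_of scale bracket \<delta> l s"
          by auto
        then show "L \<in> ?A"
          using lie_fibre_affgebra_of[of \<delta> l s] unfolding D lie_affgebras_with_fibre_def by blast
      qed
      show "?A \<subseteq> ?F ` ?D"
      proof
        fix L
        assume L: "L \<in> ?A"
        obtain \<delta> l s where "Vector_Spaces.linear scale scale \<delta>"
          and "Vector_Spaces.linear scale scale l" and eq: "L = affgebra_of scale bracket \<delta> l s"
          using affgebra_of_parameters[OF L] .
        with L have "((\<delta>, l, l), s) \<in> ?D"
          unfolding D by (simp add: lie_affgebras_with_fibre_def)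
        then show "L \<in> ?F ` ?D"
          unfolding eq by (rule rev_image_eqI) simp
      qed
    qed
  qed
qed

end
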